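(* Let $q\ge 1$ and let $x=(x_1,\dots,x_q,0,0,\dots)$ be an element of the unit sphere of $\ell^2(\mathbb{N}^\star)$ such that $x_1^2,\dots,x_q^2$ are rationally independent (i.e. linearly independent over $\mathbb{Q}$). Then there exists a constant $C_x$, depending only on $x$, such that for every $y=(y_i)_{i\ge1}$ in the unit sphere of $\ell^2(\mathbb{N}^\star)$, $$d_\sigma(x,y)\le C_x\sqrt{\sum_{i=1}^\infty Q_x(y_i)}.$$
   Context: $\mathbb{N}^\star=\{1,2,3,\dots\}$. $\ell^2(\mathbb{N}^\star)$ is the Hilbert space of real sequences $u=(u_n)_{n\ge1}$ with $\|u\|_2^2=\sum_n u_n^2<\infty$; its unit sphere is the set of $u$ with $\|u\|_2=1$. Let $\sigma(\mathbb{N}^\star)$ be the set of permutations (bijections) of $\mathbb{N}^\star$. For $x,y$ in the unit sphere with $x$ finitely supported, $$d_\sigma(x,y)=\inf_{\pi\in\sigma(\mathbb{N}^\star)}\Big(\sum_{i=1}^\infty (x_i-y_{\pi(i)})^2\Big)^{1/2}.$$ For $x=(x_1,\dots,x_q,0,0,\dots)$, $Q_x(t)=t^2\prod_{i=1}^q(t-x_i)^2$. *)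

theory Defs
  imports "HOL-Analysis.Analysis" "HOL-Combinatorics.Permutations"
begin

text \<open>
  Sequences indexed by \<open>{1, 2, 3, \<dots>}\<close> are functions of type \<^typ>\<open>nat \<Rightarrow> real\<close> of which only the
  values on \<^term>\<open>{1::nat..}\<close> are ever used; the value at \<open>0\<close> is irrelevant.
\<close>

definition ell2 :: "(nat \<Rightarrow> real) set" where
  "ell2 = {u. (\<lambda>n. (u n)\<^sup>2) summable_on {1..}}"

definition ell2_norm :: "(nat \<Rightarrow> real) \<Rightarrow> real" where
  "ell2_norm u = sqrt (\<Sum>\<^sub>\<infinity>n\<in>{1..}. (u n)\<^sup>2)"

definition ell2_sphere :: "(nat \<Rightarrow> real) set" where
  "ell2_sphere = {u \<in> ell2. ell2_norm u = 1}"

definition d_sigma :: "(nat \<Rightarrow> real) \<Rightarrow> (nat \<Rightarrow> real) \<Rightarrow> real" where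
  "d_sigma x y = (INF \<pi>\<in>{\<pi>. \<pi> permutes {1..}}. sqrt (\<Sum>\<^sub>\<infinity>i\<in>{1..}. (x i - y (\<pi> i))\<^sup>2))"

definition Q :: "nat \<Rightarrow> (nat \<Rightarrow> real) \<Rightarrow> real \<Rightarrow> real" where
  "Q q x t = t\<^sup>2 * (\<Prod>i=1..q. (t - x i)\<^sup>2)"

text \<open>
  Independence of the family \<open>(a i)\<close>, \<open>i \<in> I\<close>, over the rationals. The library notion concerns sets
  of vectors, so injectivity is needed to exclude repetitions within the family.
\<close>

definition rationally_independent :: "(nat \<Rightarrow> real) \<Rightarrow> nat set \<Rightarrow> bool" where
  "rationally_independent a I \<longleftrightarrow>
     inj_on a I \<and> module.independent (\<lambda>(r::rat) (v::real). of_rat r * v) (a ` I)"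

lemma rationally_independent_iff:
  assumes "finite I"
  shows "rationally_independent a I \<longleftrightarrow>
    (\<forall>c :: nat \<Rightarrow> rat. (\<Sum>i\<in>I. of_rat (c i) * a i) = 0 \<longrightarrow> (\<forall>i\<in>I. c i = 0))"
    (is "_ \<longleftrightarrow> ?R")
proof -
  interpret V: vector_space "\<lambda>(r::rat) (v::real). of_rat r * v"
    by unfold_locales (auto simp: algebra_simps of_rat_add of_rat_mult)
  have indep: "V.independent (a ` I) \<longleftrightarrow>
      (\<forall>u. (\<Sum>v\<in>a ` I. of_rat (u v) * v) = 0 \<longrightarrow> (\<forall>v\<in>a ` I. u v = 0))"
    using V.dependent_finite[of "a ` I"] assms by auto
  show ?thesis
  proof
    assume L: "rationally_independent a I"
    hence inj: "inj_on a I" and ind: "V.independent (a ` I)"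
      by (auto simp: rationally_independent_def)
    show ?R
    proof (intro allI impI)
      fix c :: "nat \<Rightarrow> rat"
      assume "(\<Sum>i\<in>I. of_rat (c i) * a i) = 0"
      hence "(\<Sum>v\<in>a ` I. of_rat (c (the_inv_into I a v)) * v) = 0"
        using inj by (simp add: sum.reindex the_inv_into_f_f)
      hence "\<forall>v\<in>a ` I. c (the_inv_into I a v) = 0"
        using ind indep by (auto dest: spec[of _ "\<lambda>v. c (the_inv_into I a v)"])
      thus "\<forall>i\<in>I. c i = 0" using inj by (auto simp: the_inv_into_f_f)
    qed
  next
    assume R: ?R
    have inj: "inj_on a I"
    proof (rule inj_onI, rule ccontr)
      fix i j assume ij: "i \<in> I" "j \<in> I" "a i = a j" "i \<noteq> j"
      define c :: "nat \<Rightarrow> rat" where "c k = (if k = i then 1 else if k = j then -1 else 0)" for k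
      have "(\<Sum>k\<in>I. of_rat (c k) * a k) = (\<Sum>k\<in>{i,j}. of_rat (c k) * a k)"
        using assms ij by (intro sum.mono_neutral_right) (auto simp: c_def)
      also have "\<dots> = 0" using ij by (simp add: c_def of_rat_minus)
      finally have "c i = 0" using R ij by blast
      thus False by (simp add: c_def)
    qed
    have "V.independent (a ` I)"
      unfolding indep
    proof (intro allI impI)
      fix u :: "real \<Rightarrow> rat"
      assume "(\<Sum>v\<in>a ` I. of_rat (u v) * v) = 0"
      hence "(\<Sum>i\<in>I. of_rat (u (a i)) * a i) = 0" using inj by (simp add: sum.reindex)
      thus "\<forall>v\<in>a ` I. u v = 0" using R by (auto dest: spec[of _ "\<lambda>i. u (a i)"])
    qed
    with inj show "rationally_independent a I" by (simp add: rationally_independent_def)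
  qed
qed

text \<open>
  \<^const>\<open>infsum\<close> of a non-summable function is \<open>0\<close>; the following facts show that this
  convention never comes into play, and that the infimum in \<^const>\<open>d_sigma\<close> is a genuine one.
\<close>

lemma d_sigma_summable:
  assumes "x \<in> ell2" "y \<in> ell2" "\<pi> permutes {1..}"
  shows "(\<lambda>i. (x i - y (\<pi> i))\<^sup>2) summable_on {1..}"
proof -
  have y: "(\<lambda>i. (y (\<pi> i))\<^sup>2) summable_on {1..}"
    using summable_on_reindex_bij_betw[OF permutes_imp_bij[OF assms(3)], of "\<lambda>n. (y n)\<^sup>2"] assms(2)
    by (simp add: ell2_def)
  have "(\<lambda>i. 2 * (x i)\<^sup>2 + 2 * (y (\<pi> i))\<^sup>2) summable_on {1..}"
    using assms(1) y by (intro summable_on_add summable_on_cmult_right) (auto simp: ell2_def)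
  thus ?thesis
  proof (rule summable_on_comparison_test)
    fix i
    have "0 \<le> (x i + y (\<pi> i))\<^sup>2" by simp
    thus "(x i - y (\<pi> i))\<^sup>2 \<le> 2 * (x i)\<^sup>2 + 2 * (y (\<pi> i))\<^sup>2"
      by (simp add: power2_eq_square algebra_simps)
  qed simp
qed

lemma d_sigma_bdd_below:
  "bdd_below ((\<lambda>\<pi>. sqrt (\<Sum>\<^sub>\<infinity>i\<in>{1..}. (x i - y (\<pi> i))\<^sup>2)) ` {\<pi>. \<pi> permutes {1..}})"
  by (rule bdd_belowI2[of _ 0]) (simp add: infsum_nonneg)

lemma Q_summable:
  assumes "y \<in> ell2_sphere"
  shows "(\<lambda>i. Q q x (y i)) summable_on {1..}"
proof -
  have s: "(\<lambda>n. (y n)\<^sup>2) summable_on {1..}" and one: "(\<Sum>\<^sub>\<infinity>n\<in>{1..}. (y n)\<^sup>2) = 1"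
    using assms by (auto simp: ell2_sphere_def ell2_def ell2_norm_def)
  have le1: "\<bar>y n\<bar> \<le> 1" if "n \<in> {1..}" for n
  proof -
    have "(\<Sum>\<^sub>\<infinity>n\<in>{n}. (y n)\<^sup>2) \<le> (\<Sum>\<^sub>\<infinity>n\<in>{1..}. (y n)\<^sup>2)"
      using that s by (intro infsum_mono_neutral) auto
    thus ?thesis using one by (simp add: abs_square_le_1)
  qed
  have "(\<lambda>i. (y i)\<^sup>2 * (\<Prod>j=1..q. (1 + \<bar>x j\<bar>)\<^sup>2)) summable_on {1..}"
    using s by (rule summable_on_cmult_left)
  thus ?thesis
  proof (rule summable_on_comparison_test)
    fix i :: nat assume i: "i \<in> {1..}"
    have "(y i - x j)\<^sup>2 \<le> (1 + \<bar>x j\<bar>)\<^sup>2" for j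
      using le1[OF i] by (intro power2_le_iff_abs_le[THEN iffD2]) auto
    thus "Q q x (y i) \<le> (y i)\<^sup>2 * (\<Prod>j=1..q. (1 + \<bar>x j\<bar>)\<^sup>2)"
      unfolding Q_def by (intro mult_left_mono prod_mono) auto
  qed (auto simp: Q_def intro!: mult_nonneg_nonneg prod_nonneg)
qed

end

theory Submission
  imports Defs
begin

text \<open>
  The polynomial \<open>Q\<close> has double zeros at \<open>0, x 1, \<dots>, x q\<close>, which are distinct by independence,
  and is bounded away from \<open>0\<close> off any neighbourhood of them. In fact \<open>Q t\<close> is at least \<open>c\<close> times
  the squared distance from \<open>t\<close> to this set of zeros, for some \<open>c > 0\<close>
  (\<open>prod_square_dist_ge_square_dist\<close>). Rounding each \<open>y i\<close> to a suitable zero \<open>w i\<close> therefore gives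
  a sequence with \<open>\<parallel>y - w\<parallel>\<^sup>2 \<le> E / c\<close>, where \<open>E\<close> is the sum of the \<open>Q (y i)\<close>.

  If the value \<open>x j\<close> is taken \<open>n j\<close> times by \<open>w\<close>, then \<open>\<parallel>w\<parallel>\<^sup>2\<close> is the sum of the \<open>n j * (x j)\<^sup>2\<close>.
  Numbers of this form have no accumulation point, because the \<open>(x j)\<^sup>2\<close> are positive
  (\<open>nat_combinations_isolated\<close>), and \<open>\<parallel>w\<parallel>\<close> is close to \<open>\<parallel>y\<parallel> = 1\<close> when \<open>E\<close> is small
  (\<open>infsum_squares_perturbation\<close>). This leaves two cases.

  \<^item> \<open>\<parallel>w\<parallel> = 1\<close>. As also \<open>\<parallel>x\<parallel> = 1\<close>, rational independence forces every \<open>n j\<close> to be \<open>1\<close>, so \<open>w\<close> is a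
    rearrangement of \<open>x\<close> (\<open>rearrangement_of_singleton_fibres\<close>), and the same rearrangement gives
    \<open>d_sigma x y \<le> \<parallel>w - y\<parallel> \<le> sqrt (E / c)\<close>.
  \<^item> \<open>\<parallel>w\<parallel> \<noteq> 1\<close>. Then \<open>E\<close> is bounded below by a positive constant depending only on \<open>x\<close>, and the
    trivial bound \<open>d_sigma x y \<le> 2\<close> is enough.
\<close>

section \<open>Products of squared distances to a finite set\<close>

lemma finite_set_separated:
  fixes Z :: "real set"
  assumes "finite Z"
  obtains \<delta> where "\<delta> > 0" "\<And>u v. u \<in> Z \<Longrightarrow> v \<in> Z \<Longrightarrow> u \<noteq> v \<Longrightarrow> 2 * \<delta> \<le> \<bar>u - v\<bar>"
proof -
  define D where "D = insert 2 ((\<lambda>(u, v). \<bar>u - v\<bar>) ` {(u, v) \<in> Z \<times> Z. u \<noteq> v})"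
  have fin: "finite D"
    unfolding D_def using assms by (auto intro: finite_subset[of _ "Z \<times> Z"])
  have "Min D \<in> D" using fin by (intro Min_in) (auto simp: D_def)
  hence "Min D > 0" by (auto simp: D_def)
  moreover have "2 * (Min D / 2) \<le> \<bar>u - v\<bar>" if "u \<in> Z" "v \<in> Z" "u \<noteq> v" for u v
    using fin that by (auto simp: D_def intro!: Min_le)
  ultimately show ?thesis using that[of "Min D / 2"] by auto
qed

text \<open>
  If \<open>z\<close> is a point of \<open>Z\<close> nearest to \<open>t\<close>, then every other point of \<open>Z\<close> is at distance at least
  half the minimal gap of \<open>Z\<close> from \<open>t\<close>. All factors but the one of \<open>z\<close> are thus bounded below,
  uniformly in \<open>t\<close>.
\<close>

lemma prod_square_dist_ge_square_dist:
  fixes Z :: "real set"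
  assumes "finite Z" "Z \<noteq> {}"
  obtains c where "c > 0" "\<And>t. \<exists>z\<in>Z. c * (t - z)\<^sup>2 \<le> (\<Prod>u\<in>Z. (t - u)\<^sup>2)"
proof -
  obtain \<delta> where \<delta>: "\<delta> > 0" and sep: "\<And>u v. u \<in> Z \<Longrightarrow> v \<in> Z \<Longrightarrow> u \<noteq> v \<Longrightarrow> 2 * \<delta> \<le> \<bar>u - v\<bar>"
    using finite_set_separated[OF assms(1)] by blast
  define c where "c = (\<delta>\<^sup>2) ^ (card Z - 1)"
  have "\<exists>z\<in>Z. c * (t - z)\<^sup>2 \<le> (\<Prod>u\<in>Z. (t - u)\<^sup>2)" for t
  proof -
    obtain z where z: "z \<in> Z" and nearest: "\<And>u. u \<in> Z \<Longrightarrow> \<bar>t - z\<bar> \<le> \<bar>t - u\<bar>"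
      using ex_is_arg_min_if_finite[OF assms, of "\<lambda>u. \<bar>t - u\<bar>"]
      by (auto simp: is_arg_min_linorder)
    have far: "\<delta>\<^sup>2 \<le> (t - u)\<^sup>2" if "u \<in> Z - {z}" for u
    proof -
      have "2 * \<delta> \<le> \<bar>u - z\<bar>" using sep[of u z] that z by auto
      hence "\<bar>\<delta>\<bar> \<le> \<bar>t - u\<bar>" using nearest[of u] that \<delta> by auto
      thus ?thesis by (simp add: abs_le_square_iff)
    qed
    have "c = (\<Prod>u\<in>Z - {z}. \<delta>\<^sup>2)" using z by (simp add: c_def card_Diff_singleton)
    also have "\<dots> \<le> (\<Prod>u\<in>Z - {z}. (t - u)\<^sup>2)" using far by (intro prod_mono) auto
    finally have "c * (t - z)\<^sup>2 \<le> (\<Prod>u\<in>Z - {z}. (t - u)\<^sup>2) * (t - z)\<^sup>2"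
      by (rule mult_right_mono) simp
    also have "\<dots> = (\<Prod>u\<in>Z. (t - u)\<^sup>2)"
      using prod.remove[OF assms(1) z, of "\<lambda>u. (t - u)\<^sup>2"] by (simp add: mult.commute)
    finally show ?thesis using z by blast
  qed
  moreover have "c > 0" using \<delta> by (simp add: c_def)
  ultimately show ?thesis using that by blast
qed

section \<open>Nonnegative integer combinations of positive reals\<close>

text \<open>
  Positivity of the weights \<open>a i\<close> bounds each coefficient by \<open>M / a i\<close>, leaving finitely many
  coefficient vectors.
\<close>

lemma finite_bounded_nat_combinations:
  fixes a :: "'i \<Rightarrow> real"
  assumes "finite I" "\<And>i. i \<in> I \<Longrightarrow> a i > 0"
  shows "finite {v. v \<le> M \<and> (\<exists>n :: 'i \<Rightarrow> nat. v = (\<Sum>i\<in>I. real (n i) * a i))}"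
proof (rule finite_subset)
  let ?B = "PiE I (\<lambda>i. {..nat \<lfloor>M / a i\<rfloor>})"
  show "finite ((\<lambda>n. \<Sum>i\<in>I. real (n i) * a i) ` ?B)"
    using assms(1) by (intro finite_imageI finite_PiE) auto
  show "{v. v \<le> M \<and> (\<exists>n :: 'i \<Rightarrow> nat. v = (\<Sum>i\<in>I. real (n i) * a i))}
      \<subseteq> (\<lambda>n. \<Sum>i\<in>I. real (n i) * a i) ` ?B"
  proof safe
    fix n :: "'i \<Rightarrow> nat"
    assume le: "(\<Sum>i\<in>I. real (n i) * a i) \<le> M"
    have "n i \<le> nat \<lfloor>M / a i\<rfloor>" if i: "i \<in> I" for i
    proof -
      have "real (n i) * a i \<le> (\<Sum>i\<in>I. real (n i) * a i)"
        using assms i by (intro member_le_sum) (simp_all add: less_imp_le)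
      hence "real (n i) \<le> M / a i" using le assms(2)[OF i] by (simp add: field_simps)
      thus ?thesis by (simp add: le_nat_floor)
    qed
    hence "restrict n I \<in> ?B" by auto
    moreover have "(\<Sum>i\<in>I. real (n i) * a i) = (\<Sum>i\<in>I. real (restrict n I i) * a i)"
      by (intro sum.cong) auto
    ultimately show "(\<Sum>i\<in>I. real (n i) * a i) \<in> (\<lambda>n. \<Sum>i\<in>I. real (n i) * a i) ` ?B"
      by blast
  qed
qed

text \<open>
  Only the finitely many combinations below \<open>b + 1\<close> can come within distance \<open>1\<close> of \<open>b\<close>.
\<close>

lemma nat_combinations_isolated:
  fixes a :: "'i \<Rightarrow> real"
  assumes "finite I" "\<And>i. i \<in> I \<Longrightarrow> a i > 0"
  obtains \<eta> where "\<eta> > 0"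
    "\<And>n :: 'i \<Rightarrow> nat. (\<Sum>i\<in>I. real (n i) * a i) \<noteq> b \<Longrightarrow> \<eta> \<le> \<bar>(\<Sum>i\<in>I. real (n i) * a i) - b\<bar>"
proof -
  let ?S = "{v. v \<le> b + 1 \<and> (\<exists>n :: 'i \<Rightarrow> nat. v = (\<Sum>i\<in>I. real (n i) * a i))}"
  have "finite ?S" using assms by (rule finite_bounded_nat_combinations)
  then obtain d where d: "d > 0" "\<And>v. v \<in> ?S \<Longrightarrow> v \<noteq> b \<Longrightarrow> d \<le> dist b v"
    using finite_set_avoid[of ?S b] by blast
  show ?thesis
  proof (rule that[of "min d 1"])
    fix n :: "'i \<Rightarrow> nat"
    let ?v = "\<Sum>i\<in>I. real (n i) * a i"
    assume "?v \<noteq> b"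
    show "min d 1 \<le> \<bar>?v - b\<bar>"
    proof (cases "?v \<le> b + 1")
      case True
      hence "?v \<in> ?S" by blast
      from d(2)[OF this \<open>?v \<noteq> b\<close>] show ?thesis by (simp add: dist_real_def abs_minus_commute)
    qed simp
  qed (use d in auto)
qed

section \<open>Square summable families\<close>

text \<open>
  A form of the triangle inequality in \<open>\<ell>\<^sup>2\<close> that speaks of squared norms only. It is the sum over
  \<open>i\<close> of an elementary inequality, in which the cross term \<open>2 f (f - g)\<close> is split by Young's
  inequality with the weight \<open>s\<close>. A small \<open>s\<close> makes the first summand harmless, and the second one
  is then small as soon as \<open>g\<close> is close to \<open>f\<close>.
\<close>

lemma infsum_squares_perturbation:
  fixes f g :: "'i \<Rightarrow> real"
  assumes f: "(\<lambda>i. (f i)\<^sup>2) summable_on A" and fg: "(\<lambda>i. (f i - g i)\<^sup>2) summable_on A"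
    and "s > 0"
  shows "(\<lambda>i. (g i)\<^sup>2) summable_on A"
    and "\<bar>(\<Sum>\<^sub>\<infinity>i\<in>A. (g i)\<^sup>2) - (\<Sum>\<^sub>\<infinity>i\<in>A. (f i)\<^sup>2)\<bar>
      \<le> s * (\<Sum>\<^sub>\<infinity>i\<in>A. (f i)\<^sup>2) + (1 + 1 / s) * (\<Sum>\<^sub>\<infinity>i\<in>A. (f i - g i)\<^sup>2)"
proof -
  have young: "\<bar>(g i)\<^sup>2 - (f i)\<^sup>2\<bar> \<le> s * (f i)\<^sup>2 + (1 + 1 / s) * (f i - g i)\<^sup>2" for i
  proof -
    have "2 * \<bar>f i * (f i - g i)\<bar> \<le> s * (f i)\<^sup>2 + (1 / s) * (f i - g i)\<^sup>2"
    proof -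
      have "0 \<le> (s * \<bar>f i\<bar> - \<bar>f i - g i\<bar>)\<^sup>2 / s" using \<open>s > 0\<close> by simp
      also have "\<dots> = s * \<bar>f i\<bar>\<^sup>2 + (1 / s) * \<bar>f i - g i\<bar>\<^sup>2 - 2 * (\<bar>f i\<bar> * \<bar>f i - g i\<bar>)"
        using \<open>s > 0\<close> by (simp add: power2_eq_square field_simps del: abs_mult_self_eq)
      also have "\<dots> = s * (f i)\<^sup>2 + (1 / s) * (f i - g i)\<^sup>2 - 2 * \<bar>f i * (f i - g i)\<bar>"
        unfolding power2_abs abs_mult ..
      finally show ?thesis by simp
    qed
    moreover have "(g i)\<^sup>2 - (f i)\<^sup>2 = (f i - g i)\<^sup>2 - 2 * (f i * (f i - g i))"
      by (simp add: power2_eq_square algebra_simps)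
    ultimately show ?thesis
      using zero_le_power2[of "f i - g i"] by (simp only: distrib_right mult_1)
  qed
  let ?h = "\<lambda>i. s * (f i)\<^sup>2 + (1 + 1 / s) * (f i - g i)\<^sup>2"
  have h: "?h summable_on A"
    using f fg by (intro summable_on_add summable_on_cmult_right)
  have hsum: "infsum ?h A = s * (\<Sum>\<^sub>\<infinity>i\<in>A. (f i)\<^sup>2) + (1 + 1 / s) * (\<Sum>\<^sub>\<infinity>i\<in>A. (f i - g i)\<^sup>2)"
    using f fg by (subst infsum_add) (auto intro: summable_on_cmult_right simp: infsum_cmult_right)
  have "(\<lambda>i. ?h i + (f i)\<^sup>2) summable_on A" using h f by (rule summable_on_add)
  thus g: "(\<lambda>i. (g i)\<^sup>2) summable_on A"
  proof (rule summable_on_comparison_test)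
    show "(g i)\<^sup>2 \<le> ?h i + (f i)\<^sup>2" for i using young[of i] by simp
  qed simp
  have "(\<Sum>\<^sub>\<infinity>i\<in>A. (g i)\<^sup>2) \<le> infsum ?h A + (\<Sum>\<^sub>\<infinity>i\<in>A. (f i)\<^sup>2)"
    unfolding infsum_add[OF h f, symmetric]
  proof (rule infsum_mono[OF g summable_on_add[OF h f]])
    show "(g i)\<^sup>2 \<le> ?h i + (f i)\<^sup>2" for i using young[of i] by simp
  qed
  moreover have "(\<Sum>\<^sub>\<infinity>i\<in>A. (f i)\<^sup>2) \<le> infsum ?h A + (\<Sum>\<^sub>\<infinity>i\<in>A. (g i)\<^sup>2)"
    unfolding infsum_add[OF h g, symmetric]
  proof (rule infsum_mono[OF f summable_on_add[OF h g]])
    show "(f i)\<^sup>2 \<le> ?h i + (g i)\<^sup>2" for i using young[of i] by simp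
  qed
  ultimately show "\<bar>(\<Sum>\<^sub>\<infinity>i\<in>A. (g i)\<^sup>2) - (\<Sum>\<^sub>\<infinity>i\<in>A. (f i)\<^sup>2)\<bar>
      \<le> s * (\<Sum>\<^sub>\<infinity>i\<in>A. (f i)\<^sup>2) + (1 + 1 / s) * (\<Sum>\<^sub>\<infinity>i\<in>A. (f i - g i)\<^sup>2)"
    unfolding hsum by simp
qed

text \<open>
  The nonzero values are bounded away from \<open>0\<close>, so the sum bounds how often they can occur.
\<close>

lemma finite_support_of_summable_finite_range:
  fixes w :: "'i \<Rightarrow> real"
  assumes "(\<lambda>i. (w i)\<^sup>2) summable_on A" "finite (w ` A)"
  shows "finite {i \<in> A. w i \<noteq> 0}"
proof -
  obtain d where d: "d > 0" "\<And>v. v \<in> w ` A \<Longrightarrow> v \<noteq> 0 \<Longrightarrow> d \<le> dist 0 v"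
    using finite_set_avoid[OF assms(2), of 0] by blast
  have "card G \<le> nat \<lfloor>(\<Sum>\<^sub>\<infinity>i\<in>A. (w i)\<^sup>2) / d\<^sup>2\<rfloor>" if G: "G \<subseteq> {i \<in> A. w i \<noteq> 0}" "finite G" for G
  proof -
    have ge: "d\<^sup>2 \<le> (w i)\<^sup>2" if "i \<in> G" for i
    proof -
      have "\<bar>d\<bar> \<le> \<bar>w i\<bar>" using G(1) that d(1) d(2)[of "w i"] by auto
      thus ?thesis by (simp add: abs_le_square_iff)
    qed
    have "real (card G) * d\<^sup>2 \<le> (\<Sum>i\<in>G. (w i)\<^sup>2)" using ge by (rule sum_bounded_below)
    also have "\<dots> \<le> (\<Sum>\<^sub>\<infinity>i\<in>A. (w i)\<^sup>2)"
      using assms(1) G by (intro finite_sum_le_infsum) auto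
    finally show ?thesis using d(1) by (intro le_nat_floor) (simp add: field_simps)
  qed
  thus ?thesis using finite_if_finite_subsets_card_bdd by blast
qed

section \<open>Rearrangements\<close>

text \<open>
  Inside the finite set \<open>S \<union> T\<close>, the complements of \<open>S\<close> and of \<open>T\<close> have equally many elements;
  any bijection between them completes \<open>f\<close> to a permutation of \<open>S \<union> T\<close>, which can be the identity
  elsewhere.
\<close>

lemma bij_betw_finite_extends_to_permutation:
  assumes f: "bij_betw f S T" and "finite S" "S \<subseteq> U" "T \<subseteq> U"
  obtains p where "p permutes U" "\<And>s. s \<in> S \<Longrightarrow> p s = f s"
proof -
  have "finite T" using f \<open>finite S\<close> bij_betw_finite by blast
  have card: "card S = card T" using f by (rule bij_betw_same_card)
  let ?N = "S \<union> T"
  have "card (?N - S) = card (?N - T)"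
    using \<open>finite S\<close> \<open>finite T\<close> card by (subst (1 2) card_Diff_subset) auto
  then obtain h where h: "bij_betw h (?N - S) (?N - T)"
    using finite_same_card_bij[of "?N - S" "?N - T"] \<open>finite S\<close> \<open>finite T\<close> by auto
  define p where "p i = (if i \<in> S then f i else if i \<in> ?N then h i else i)" for i
  have "bij_betw p S T" using f by (rule bij_betw_cong[THEN iffD1, rotated]) (simp add: p_def)
  moreover have "bij_betw p (?N - S) (?N - T)"
    using h by (rule bij_betw_cong[THEN iffD1, rotated]) (auto simp: p_def)
  ultimately have "bij_betw p (S \<union> (?N - S)) (T \<union> (?N - T))"
    by (rule bij_betw_combine) auto
  hence "bij_betw p ?N ?N" by (simp add: Un_absorb1 Un_Diff_cancel sup_commute)
  hence "p permutes ?N" by (rule bij_imp_permutes) (auto simp: p_def)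
  hence "p permutes U" by (rule permutes_subset) (use assms in auto)
  thus ?thesis using that[of p] by (simp add: p_def)
qed

lemma d_sigma_le:
  assumes "\<pi> permutes {1..}"
  shows "d_sigma x y \<le> sqrt (\<Sum>\<^sub>\<infinity>i\<in>{1..}. (x i - y (\<pi> i))\<^sup>2)"
  unfolding d_sigma_def by (rule cINF_lower[OF d_sigma_bdd_below]) (use assms in simp)

lemma ell2_sphere_iff:
  "u \<in> ell2_sphere \<longleftrightarrow> (\<lambda>n. (u n)\<^sup>2) summable_on {1..} \<and> (\<Sum>\<^sub>\<infinity>n\<in>{1..}. (u n)\<^sup>2) = 1"
  by (auto simp: ell2_sphere_def ell2_def ell2_norm_def)

text \<open>
  The identity permutation already achieves this bound, since \<open>\<parallel>x - y\<parallel>\<^sup>2 \<le> 2 \<parallel>x\<parallel>\<^sup>2 + 2 \<parallel>y\<parallel>\<^sup>2\<close>.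
\<close>

lemma d_sigma_le_2:
  assumes "x \<in> ell2_sphere" "y \<in> ell2_sphere"
  shows "d_sigma x y \<le> 2"
proof -
  have x: "(\<lambda>n. (x n)\<^sup>2) summable_on {1..}" "(\<Sum>\<^sub>\<infinity>n\<in>{1..}. (x n)\<^sup>2) = 1"
    and y: "(\<lambda>n. (y n)\<^sup>2) summable_on {1..}" "(\<Sum>\<^sub>\<infinity>n\<in>{1..}. (y n)\<^sup>2) = 1"
    using assms by (auto simp: ell2_sphere_iff)
  have "(\<Sum>\<^sub>\<infinity>i\<in>{1..}. (x i - y i)\<^sup>2) \<le> (\<Sum>\<^sub>\<infinity>i\<in>{1..}. 2 * (x i)\<^sup>2 + 2 * (y i)\<^sup>2)"
  proof (rule infsum_mono)
    show "(\<lambda>i. (x i - y i)\<^sup>2) summable_on {1..}"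
      using d_sigma_summable[of x y id] assms by (simp add: permutes_id ell2_sphere_def)
    show "(\<lambda>i. 2 * (x i)\<^sup>2 + 2 * (y i)\<^sup>2) summable_on {1..}"
      using x y by (intro summable_on_add summable_on_cmult_right)
    show "(x i - y i)\<^sup>2 \<le> 2 * (x i)\<^sup>2 + 2 * (y i)\<^sup>2" for i
      using zero_le_power2[of "x i + y i"] by (simp add: power2_eq_square algebra_simps)
  qed
  also have "\<dots> = 4"
    using x y by (subst infsum_add) (auto intro: summable_on_cmult_right simp: infsum_cmult_right)
  finally have "sqrt (\<Sum>\<^sub>\<infinity>i\<in>{1..}. (x i - y i)\<^sup>2) \<le> 2"
    by (metis real_sqrt_four real_sqrt_le_iff)
  thus ?thesis using d_sigma_le[OF permutes_id, of x y] by simp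
qed

text \<open>
  Sending \<open>j \<le> q\<close> to the only place where \<open>w\<close> takes the value \<open>x j\<close> is a bijection from
  \<open>{1..q}\<close> onto the support of \<open>w\<close>. Any permutation extending it maps the indices beyond \<open>q\<close> off
  this support, where \<open>w\<close> and \<open>x\<close> are both zero.
\<close>

lemma rearrangement_of_singleton_fibres:
  fixes w x :: "nat \<Rightarrow> 'a::zero"
  assumes range: "w ` {1..} \<subseteq> insert 0 (x ` {1..q})"
    and inj: "inj_on x {1..q}" and zero: "0 \<notin> x ` {1..q}"
    and fibre: "\<And>j. j \<in> {1..q} \<Longrightarrow> card {i \<in> {1..}. w i = x j} = 1"
    and supp: "\<And>i. i > q \<Longrightarrow> x i = 0"
  obtains \<pi> where "\<pi> permutes {1..}" "\<And>i. i \<ge> 1 \<Longrightarrow> w (\<pi> i) = x i"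
proof -
  have "\<forall>j\<in>{1..q}. \<exists>k. {i \<in> {1..}. w i = x j} = {k}"
    using fibre by (meson card_1_singletonE)
  then obtain f where f: "\<And>j. j \<in> {1..q} \<Longrightarrow> {i \<in> {1..}. w i = x j} = {f j}"
    by metis
  have f1: "f j \<ge> 1" "w (f j) = x j" if "j \<in> {1..q}" for j
    using f[OF that] by auto
  define T where "T = {i \<in> {1..}. w i \<noteq> 0}"
  have bij: "bij_betw f {1..q} T"
    unfolding bij_betw_def
  proof
    show "inj_on f {1..q}" using f1(2) inj by (metis inj_on_def)
    show "f ` {1..q} = T"
    proof safe
      fix j assume "j \<in> {1..q}"
      thus "f j \<in> T" using f1[of j] zero by (force simp: T_def)
    next
      fix i assume "i \<in> T"
      then obtain j where "j \<in> {1..q}" "w i = x j" "i \<ge> 1" using range by (force simp: T_def)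
      thus "i \<in> f ` {1..q}" using f[of j] by blast
    qed
  qed
  have "T \<subseteq> {1..}" by (auto simp: T_def)
  then obtain \<pi> where \<pi>: "\<pi> permutes {1..}" "\<And>j. j \<in> {1..q} \<Longrightarrow> \<pi> j = f j"
    using bij_betw_finite_extends_to_permutation[OF bij, of "{1..}"] by auto
  have T: "f ` {1..q} = T" using bij by (simp add: bij_betw_def)
  have "w (\<pi> i) = x i" if "i \<ge> 1" for i
  proof (cases "i \<le> q")
    case True
    thus ?thesis using \<pi>(2)[of i] f1(2)[of i] that by simp
  next
    case False
    have "\<pi> i \<notin> T"
    proof
      assume "\<pi> i \<in> T"
      then obtain j where "j \<in> {1..q}" "\<pi> i = \<pi> j" using T \<pi>(2) by auto
      thus False using False permutes_inj[OF \<pi>(1)] by (auto dest: injD)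
    qed
    moreover have "\<pi> i \<ge> 1" using permutes_in_image[OF \<pi>(1), of i] that by simp
    ultimately show ?thesis using False supp[of i] by (auto simp: T_def)
  qed
  thus ?thesis using that \<pi>(1) by blast
qed

section \<open>Norms of sequences with values in a finite set\<close>

lemma infsum_squares_eq_fibre_cards:
  fixes w :: "'i \<Rightarrow> real"
  assumes "finite Z" "0 \<notin> Z" "w ` A \<subseteq> insert 0 Z" "(\<lambda>i. (w i)\<^sup>2) summable_on A"
  shows "(\<Sum>\<^sub>\<infinity>i\<in>A. (w i)\<^sup>2) = (\<Sum>z\<in>Z. real (card {i \<in> A. w i = z}) * z\<^sup>2)"
proof -
  let ?T = "{i \<in> A. w i \<noteq> 0}"
  have fin: "finite ?T"
    using assms by (intro finite_support_of_summable_finite_range) (auto intro: finite_subset)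
  have "(\<Sum>\<^sub>\<infinity>i\<in>A. (w i)\<^sup>2) = (\<Sum>\<^sub>\<infinity>i\<in>?T. (w i)\<^sup>2)"
    by (rule infsum_cong_neutral) auto
  also have "\<dots> = (\<Sum>i\<in>?T. (w i)\<^sup>2)" using fin by simp
  also have "\<dots> = (\<Sum>z\<in>Z. \<Sum>i\<in>{i \<in> ?T. w i = z}. (w i)\<^sup>2)"
    using assms fin by (intro sum.group[symmetric]) auto
  also have "\<dots> = (\<Sum>z\<in>Z. real (card {i \<in> A. w i = z}) * z\<^sup>2)"
  proof (rule sum.cong)
    fix z assume "z \<in> Z"
    hence "{i \<in> ?T. w i = z} = {i \<in> A. w i = z}" using assms(2) by auto
    thus "(\<Sum>i\<in>{i \<in> ?T. w i = z}. (w i)\<^sup>2) = real (card {i \<in> A. w i = z}) * z\<^sup>2"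
      by simp
  qed simp
  finally show ?thesis .
qed

section \<open>Consequences of rational independence\<close>

lemma rationally_independent_nonzero:
  assumes "rationally_independent a I" "finite I" "i \<in> I"
  shows "a i \<noteq> 0"
proof
  assume "a i = 0"
  hence "(\<Sum>k\<in>I. of_rat ((if k = i then 1 else 0) :: rat) * a k) = 0"
    by (intro sum.neutral) auto
  thus False
    using assms(1,3) unfolding rationally_independent_iff[OF assms(2)]
    by (auto dest!: spec[of _ "\<lambda>k. if k = i then 1 else 0"])
qed

text \<open>
  The form in which independence enters: a natural number combination determines its coefficients.
\<close>

lemma rationally_independent_nat_combinations:
  fixes n m :: "nat \<Rightarrow> nat"
  assumes "rationally_independent a I" "finite I"
    and "(\<Sum>i\<in>I. real (n i) * a i) = (\<Sum>i\<in>I. real (m i) * a i)" "i \<in> I"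
  shows "n i = m i"
proof -
  have "(\<Sum>i\<in>I. of_rat (of_nat (n i) - of_nat (m i)) * a i) = 0"
    using assms(3) by (simp add: of_rat_diff left_diff_distrib sum_subtractf)
  thus ?thesis
    using assms(1,4) unfolding rationally_independent_iff[OF assms(2)]
    by (auto dest: spec[of _ "\<lambda>i. of_nat (n i) - of_nat (m i)"])
qed

section \<open>Comparison of the permutation distance with the sum of Q\<close>

theorem theorem2p1:
  fixes q :: nat and x :: "nat \<Rightarrow> real"
  assumes "q \<ge> 1"
    and "x \<in> ell2_sphere"
    and "\<And>i. i > q \<Longrightarrow> x i = 0"
    and "rationally_independent (\<lambda>i. (x i)\<^sup>2) {1..q}"
  shows "\<exists>C::real. \<forall>y\<in>ell2_sphere. d_sigma x y \<le> C * sqrt (\<Sum>\<^sub>\<infinity>i\<in>{1..}. Q q x (y i))"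
proof -
  note indep = assms(4)
  have nz: "x j \<noteq> 0" if "j \<in> {1..q}" for j
    using rationally_independent_nonzero[OF indep _ that] by simp
  have inj: "inj_on x {1..q}"
  proof (rule inj_onI)
    fix i j assume ij: "i \<in> {1..q}" "j \<in> {1..q}" and "x i = x j"
    have "inj_on (\<lambda>i. (x i)\<^sup>2) {1..q}"
      using indep unfolding rationally_independent_def by (rule conjunct1)
    thus "i = j" by (rule inj_onD) (use ij \<open>x i = x j\<close> in simp_all)
  qed
  define Z where "Z = x ` {1..q}"
  have Z: "finite Z" "0 \<notin> Z" using nz by (auto simp: Z_def)
  have Q_eq: "Q q x = (\<lambda>t. \<Prod>u\<in>insert 0 Z. (t - u)\<^sup>2)"
  proof
    fix t
    have "(\<Prod>u\<in>Z. (t - u)\<^sup>2) = (\<Prod>i=1..q. (t - x i)\<^sup>2)"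
      unfolding Z_def prod.reindex[OF inj] by simp
    thus "Q q x t = (\<Prod>u\<in>insert 0 Z. (t - u)\<^sup>2)" using Z by (simp add: Q_def)
  qed
  obtain c where c: "c > 0" "\<And>t. \<exists>z\<in>insert 0 Z. c * (t - z)\<^sup>2 \<le> Q q x t"
    unfolding Q_eq using Z(1) prod_square_dist_ge_square_dist[of "insert 0 Z"] by blast
  then obtain near where near: "\<And>t. near t \<in> insert 0 Z" "\<And>t. c * (t - near t)\<^sup>2 \<le> Q q x t"
    by metis
  have x_norm: "(\<Sum>j\<in>{1..q}. real 1 * (x j)\<^sup>2) = 1"
  proof -
    have "(\<Sum>\<^sub>\<infinity>n\<in>{1..}. (x n)\<^sup>2) = (\<Sum>\<^sub>\<infinity>n\<in>{1..q}. (x n)\<^sup>2)"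
      using assms(3) by (intro infsum_cong_neutral) auto
    thus ?thesis using assms(2) by (simp add: ell2_sphere_iff)
  qed
  obtain \<eta> where \<eta>: "\<eta> > 0" and isolated: "\<And>n :: nat \<Rightarrow> nat. (\<Sum>j\<in>{1..q}. real (n j) * (x j)\<^sup>2) \<noteq> 1
      \<Longrightarrow> \<eta> \<le> \<bar>(\<Sum>j\<in>{1..q}. real (n j) * (x j)\<^sup>2) - 1\<bar>"
    using nat_combinations_isolated[of "{1..q}" "\<lambda>j. (x j)\<^sup>2" 1] nz by auto
  \<comment> \<open>The value of \<open>D\<close> for which \<open>\<eta> = s + (1 + 1 / s) * D\<close> with \<open>s = \<eta> / 2\<close>: a perturbation
    with \<open>\<parallel>y - w\<parallel>\<^sup>2 < \<kappa>\<close> changes the squared norm \<open>1\<close> by less than the gap \<open>\<eta>\<close>.\<close>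
  define \<kappa> where "\<kappa> = (\<eta> / 2) / (1 + 2 / \<eta>)"
  have \<kappa>: "\<kappa> > 0" using \<eta> by (simp add: \<kappa>_def add_pos_pos)
  \<comment> \<open>The entries serve the cases \<open>\<parallel>w\<parallel> = 1\<close> and \<open>\<parallel>w\<parallel> \<noteq> 1\<close>.\<close>
  define C where "C = max (1 / sqrt c) (2 / sqrt (c * \<kappa>))"
  have "d_sigma x y \<le> C * sqrt (\<Sum>\<^sub>\<infinity>i\<in>{1..}. Q q x (y i))" if y: "y \<in> ell2_sphere" for y
  proof -
    define E where "E = (\<Sum>\<^sub>\<infinity>i\<in>{1..}. Q q x (y i))"
    have "E \<ge> 0" unfolding E_def by (intro infsum_nonneg) (simp add: Q_def prod_nonneg)
    have y2: "(\<lambda>i. (y i)\<^sup>2) summable_on {1..}" "(\<Sum>\<^sub>\<infinity>i\<in>{1..}. (y i)\<^sup>2) = 1"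
      using y by (auto simp: ell2_sphere_iff)
    define w where "w i = near (y i)" for i
    define D where "D = (\<Sum>\<^sub>\<infinity>i\<in>{1..}. (y i - w i)\<^sup>2)"
    have near_le: "(y i - w i)\<^sup>2 \<le> (1 / c) * Q q x (y i)" for i
      using near(2)[of "y i"] c(1) by (simp add: w_def field_simps)
    have Qs: "(\<lambda>i. (1 / c) * Q q x (y i)) summable_on {1..}"
      using Q_summable[OF y] by (rule summable_on_cmult_right)
    have yw: "(\<lambda>i. (y i - w i)\<^sup>2) summable_on {1..}"
      using Qs near_le by (rule summable_on_comparison_test) simp
    have "D \<le> (\<Sum>\<^sub>\<infinity>i\<in>{1..}. (1 / c) * Q q x (y i))"
      unfolding D_def using yw Qs near_le by (rule infsum_mono)
    also have "\<dots> = (1 / c) * E"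
      unfolding E_def by (rule infsum_cmult_right')
    finally have D_le: "D \<le> E / c" by simp
    have w_range: "w ` {1..} \<subseteq> insert 0 (x ` {1..q})"
      using near(1) by (auto simp: w_def Z_def)
    define n where "n j = card {i \<in> {1..}. w i = x j}" for j
    have w2: "(\<lambda>i. (w i)\<^sup>2) summable_on {1..}"
      using infsum_squares_perturbation(1)[OF y2(1) yw, of 1] by simp
    have "(\<Sum>\<^sub>\<infinity>i\<in>{1..}. (w i)\<^sup>2) = (\<Sum>z\<in>Z. real (card {i \<in> {1..}. w i = z}) * z\<^sup>2)"
      using w_range by (intro infsum_squares_eq_fibre_cards[OF Z _ w2]) (simp add: Z_def)
    hence w_norm: "(\<Sum>\<^sub>\<infinity>i\<in>{1..}. (w i)\<^sup>2) = (\<Sum>j\<in>{1..q}. real (n j) * (x j)\<^sup>2)"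
      unfolding Z_def sum.reindex[OF inj] n_def by simp
    show ?thesis
    proof (cases "(\<Sum>j\<in>{1..q}. real (n j) * (x j)\<^sup>2) = 1")
      case True
      have "n j = 1" if "j \<in> {1..q}" for j
        using rationally_independent_nat_combinations[OF indep _ _ that, of n "\<lambda>_. 1"] True x_norm
        by simp
      then obtain \<pi> where \<pi>: "\<pi> permutes {1..}" "\<And>i. i \<ge> 1 \<Longrightarrow> w (\<pi> i) = x i"
        using rearrangement_of_singleton_fibres[OF w_range inj _ _ assms(3)] Z(2)
        unfolding n_def Z_def by metis
      have "(\<Sum>\<^sub>\<infinity>i\<in>{1..}. (x i - y (\<pi> i))\<^sup>2) = (\<Sum>\<^sub>\<infinity>i\<in>{1..}. (y (\<pi> i) - w (\<pi> i))\<^sup>2)"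
        using \<pi>(2) by (intro infsum_cong) (simp add: power2_commute)
      also have "\<dots> = D"
        unfolding D_def by (rule infsum_reindex_bij_betw[OF permutes_imp_bij[OF \<pi>(1)]])
      finally have "d_sigma x y \<le> sqrt D" using d_sigma_le[OF \<pi>(1), of x y] by simp
      also have "\<dots> \<le> sqrt (E / c)" using D_le by simp
      also have "\<dots> = (1 / sqrt c) * sqrt E" by (simp add: real_sqrt_divide)
      also have "\<dots> \<le> C * sqrt E"
        by (rule mult_right_mono) (use \<open>E \<ge> 0\<close> in \<open>auto simp: C_def\<close>)
      finally show ?thesis unfolding E_def .
    next
      case False
      have "\<eta> \<le> \<bar>(\<Sum>\<^sub>\<infinity>i\<in>{1..}. (w i)\<^sup>2) - (\<Sum>\<^sub>\<infinity>i\<in>{1..}. (y i)\<^sup>2)\<bar>"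
        unfolding w_norm y2(2) by (rule isolated[OF False])
      also have "\<dots> \<le> \<eta> / 2 + (1 + 2 / \<eta>) * D"
        using infsum_squares_perturbation(2)[OF y2(1) yw, of "\<eta> / 2"] \<eta>
        unfolding y2(2) D_def by simp
      finally have "\<kappa> \<le> D"
        using \<eta> unfolding \<kappa>_def by (subst pos_divide_le_eq) (auto simp: add_pos_pos mult.commute)
      hence "\<kappa> \<le> E / c" using D_le by (rule order_trans)
      hence "c * \<kappa> \<le> E" using c(1) by (simp add: field_simps)
      hence "sqrt (c * \<kappa>) \<le> sqrt E" by simp
      hence "2 \<le> (2 / sqrt (c * \<kappa>)) * sqrt E" using c(1) \<kappa> by (simp add: field_simps)
      also have "\<dots> \<le> C * sqrt E"
        by (rule mult_right_mono) (use \<open>E \<ge> 0\<close> in \<open>auto simp: C_def\<close>)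
      finally show ?thesis using d_sigma_le_2[OF assms(2) y] unfolding E_def by simp
    qed
  qed
  thus ?thesis by blast
qed

end
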